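(* The number of peaks of a Dyck path $P\in D_n$ is given by $$|\mathcal{F}_P|+\|\mathcal{F}_{\sim P}\|-|\mathcal{F}_{\sim P}^*|.$$
   Context: A Dyck path of semilength $n$ is a lattice path from $(0,0)$ to $(2n,0)$ using steps $u=(1,1)$ and $d=(1,-1)$ and never going below the $x$-axis. A peak is a pair of consecutive steps $ud$. $D_n$ is the set of Dyck paths of semilength $n$, ordered by $P\le Q$ iff $P$ lies weakly below $Q$; it is a finite distributive lattice with minimum $0=(ud)^n$, hence a Heyting algebra, with pseudocomplement $\sim\! P=\bigvee\{Z\in D_n : P\wedge Z=0\}$. Put $[n-1]=\{1,\ldots,n-1\}$. The join-irreducible elements of $D_n$ (other than the minimum) are the paths $J_{[a,b]}=(ud)^{a-1}u^{b-a+2}d^{b-a+2}(ud)^{n-1-b}$ for nonempty intervals $[a,b]=\{a,\ldots,b\}$ of $[n-1]$; the atoms are the $J_{[i,i]}$ ($J_{[i,i]}$ is the atom of order $i$), and the atoms below $J_{[a,b]}$ are those of orders in $[a,b]$. For $P\in D_n$, $\mathcal{F}_P$ denotes the antichain (with respect to inclusion) of intervals of $[n-1]$ representing $P$: it consists of the intervals $I$ such that $J_I$ occurs in the irredundant decomposition of $P$ as a join of join-irreducibles, i.e. the inclusion-maximal intervals $I$ with $J_I\le P$. If $\mathcal{F}_P=\{I_1,\ldots,I_m\}$, then $|\mathcal{F}_P|=m$ and $\|\mathcal{F}_P\|=|I_1\cup\cdots\cup I_m|$. An interval $I\in\mathcal{F}_P$ is internal if $1\notin I$ and $n-1\notin I$;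 $\mathcal{F}_P^*$ is the set of internal intervals of $\mathcal{F}_P$.
   Formalization: The formal statement assumes that P is not the minimum 0 = (ud)^n: for P = 0 and n ≥ 1 the path has n peaks, while F_P is empty and the formula gives n-1, so the claim fails there. *)

theory Defs
  imports "HOL-Algebra.Complete_Lattice"
begin

datatype step = U | D

definition height :: "step list \<Rightarrow> int" where
  "height w = (\<Sum>s\<leftarrow>w. case s of U \<Rightarrow> 1 | D \<Rightarrow> - 1)"

definition dyck_paths :: "nat \<Rightarrow> step list set" where
  "dyck_paths n =
     {w. length w = 2 * n \<and> height w = 0 \<and> (\<forall>k \<le> 2 * n. 0 \<le> height (take k w))}"

(* Both paths are linear between consecutive integer abscissae, so it suffices to compare
   ordinates at the integer ones. *)
definition weakly_below :: "step list \<Rightarrow> step list \<Rightarrow> bool" where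
  "weakly_below P Q \<longleftrightarrow> (\<forall>k. height (take k P) \<le> height (take k Q))"

definition dyck_lattice :: "nat \<Rightarrow> step list gorder" where
  "dyck_lattice n = \<lparr>carrier = dyck_paths n, eq = (=), le = weakly_below\<rparr>"

definition dyck_zero :: "nat \<Rightarrow> step list" where
  "dyck_zero n = concat (replicate n [U, D])"

definition pseudocomplement :: "nat \<Rightarrow> step list \<Rightarrow> step list" where
  "pseudocomplement n P =
     \<Squnion>\<^bsub>dyck_lattice n\<^esub>{Z \<in> dyck_paths n. P \<sqinter>\<^bsub>dyck_lattice n\<^esub> Z = dyck_zero n}"

definition num_peaks :: "step list \<Rightarrow> nat" where
  "num_peaks P = card {i. Suc i < length P \<and> P ! i = U \<and> P ! Suc i = D}"

(* The join-irreducible path indexed by the interval [a,b], meant for 1 \<le> a \<le> b \<le> n - 1;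
   for such a, b the truncated subtractions below are exact. *)
definition join_irr :: "nat \<Rightarrow> nat \<Rightarrow> nat \<Rightarrow> step list" where
  "join_irr n a b =
     concat (replicate (a - 1) [U, D]) @ replicate (b - a + 2) U @ replicate (b - a + 2) D @
     concat (replicate (n - 1 - b) [U, D])"

definition intervals_below :: "nat \<Rightarrow> step list \<Rightarrow> nat set set" where
  "intervals_below n P =
     {{a..b} | a b. 1 \<le> a \<and> a \<le> b \<and> b \<le> n - 1 \<and> weakly_below (join_irr n a b) P}"

(* The antichain representing P. *)
definition max_intervals :: "nat \<Rightarrow> step list \<Rightarrow> nat set set" where
  "max_intervals n P =
     {I \<in> intervals_below n P. \<forall>K \<in> intervals_below n P. I \<subseteq> K \<longrightarrow> K = I}"

definition internal_intervals :: "nat \<Rightarrow> step list \<Rightarrow> nat set set" where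
  "internal_intervals n P = {I \<in> max_intervals n P. 1 \<notin> I \<and> n - 1 \<notin> I}"

end

theory Submission
  imports Defs
begin

text \<open>
  Let \<open>h\<close> be the height function of \<open>P\<close>. A join-irreducible \<open>J\<^bsub>[a,b]\<^esub>\<close> lies below \<open>P\<close> iff
  \<open>h (a + b) \<ge> b - a + 2\<close>, and \<open>[a,b]\<close> is maximal with this property iff \<open>P\<close> has a peak of height
  exactly \<open>b - a + 2\<close> at abscissa \<open>a + b\<close>; so the intervals representing \<open>P\<close> count the peaks of
  height at least 2. The remaining peaks have height 1 and correspond to the pairs of consecutive
  zeros \<open>h (2 j) = h (2 j + 2) = 0\<close>.

  Let \<open>A\<close> be the set of orders of the atoms below \<open>P\<close>. The intervals below the pseudocomplement are
  those disjoint from \<open>A\<close>, so its representing intervals are the runs of \<open>{1..n - 1} - A\<close>.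
  Adjoining the zeros at \<open>0\<close> and \<open>n\<close>, the complement of \<open>A\<close> in \<open>{0..n}\<close> has two more elements, and its
  runs are the internal ones together with the run of \<open>0\<close> and the run of \<open>n\<close>, which are distinct
  because \<open>A\<close> is nonempty. As a set of \<open>c\<close> integers with \<open>r\<close> runs has \<open>c - r\<close> consecutive pairs, the
  two extra elements and the two extra runs cancel.
\<close>

section \<open>Heights along a path\<close>

text \<open>The ordinate at abscissa \<open>k\<close>; as \<open>take\<close> saturates, it stays at
  the final height for \<open>k\<close> past the end.\<close>

definition elevation :: "step list \<Rightarrow> nat \<Rightarrow> int" where
  "elevation w k = height (take k w)"

lemma height_Nil [simp]: "height [] = 0"
  by (simp add: height_def)

lemma height_append [simp]: "height (v @ w) = height v + height w"
  by (simp add: height_def)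

lemma height_Cons [simp]: "height (s # w) = (case s of U \<Rightarrow> 1 | D \<Rightarrow> - 1) + height w"
  by (simp add: height_def)

lemma height_replicate [simp]: "height (replicate m s) = int m * (case s of U \<Rightarrow> 1 | D \<Rightarrow> - 1)"
  by (induction m) (auto simp: algebra_simps)

lemma height_zigzag [simp]: "height (concat (replicate m [U, D])) = 0"
  by (induction m) auto

lemma length_zigzag [simp]: "length (concat (replicate m [U, D])) = 2 * m"
  by (induction m) auto

lemma elevation_0 [simp]: "elevation w 0 = 0"
  by (simp add: elevation_def)

lemma elevation_append:
  "elevation (v @ w) k =
     (if k \<le> length v then elevation v k else height v + elevation w (k - length v))"
  by (simp add: elevation_def)

lemma elevation_Suc:
  assumes "k < length w"
  shows "elevation w (Suc k) = elevation w k + (case w ! k of U \<Rightarrow> 1 | D \<Rightarrow> - 1)"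
  using assms by (simp add: elevation_def take_Suc_conv_app_nth)

lemma nth_eq_U_iff:
  assumes "k < length w"
  shows "w ! k = U \<longleftrightarrow> elevation w (Suc k) = elevation w k + 1"
  using elevation_Suc[OF assms] by (cases "w ! k") auto

lemma nth_eq_D_iff:
  assumes "k < length w"
  shows "w ! k = D \<longleftrightarrow> elevation w (Suc k) = elevation w k - 1"
  using elevation_Suc[OF assms] by (cases "w ! k") auto

lemma elevation_step:
  assumes "k < length w"
  shows "elevation w (Suc k) = elevation w k + 1 \<or> elevation w (Suc k) = elevation w k - 1"
  using elevation_Suc[OF assms] by (cases "w ! k") auto

lemma elevation_eqI:
  assumes "length v = length w" and "\<And>k. k \<le> length w \<Longrightarrow> elevation v k = elevation w k"
  shows "v = w"
proof (rule nth_equalityI)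
  fix k assume k: "k < length v"
  then have "v ! k = U \<longleftrightarrow> w ! k = U"
    using assms by (simp add: nth_eq_U_iff)
  then show "v ! k = w ! k"
    by (metis (full_types) step.exhaust)
qed (fact assms(1))

text \<open>Each step flips both parities. Hence two paths differ in height by an even number at any
  common abscissa, which later excludes values off by one.\<close>

lemma even_elevation_iff:
  assumes "k \<le> length w"
  shows "even (elevation w k) \<longleftrightarrow> even k"
  using assms
proof (induction k)
  case (Suc k)
  with elevation_step[of k w] show ?case by auto
qed simp

lemma elevation_lipschitz_aux:
  assumes "j + d \<le> length w"
  shows "\<bar>elevation w (j + d) - elevation w j\<bar> \<le> int d"
  using assms
proof (induction d)
  case (Suc d)
  with elevation_step[of "j + d" w] show ?case by auto
qed simp

lemma elevation_lipschitz:
  assumes "j \<le> length w" and "k \<le> length w"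
  shows "\<bar>elevation w k - elevation w j\<bar> \<le> \<bar>int k - int j\<bar>"
proof (cases "j \<le> k")
  case True
  with elevation_lipschitz_aux[of j "k - j" w] assms show ?thesis by simp
next
  case False
  with elevation_lipschitz_aux[of k "j - k" w] assms show ?thesis by simp
qed

lemma dyck_paths_iff:
  "w \<in> dyck_paths n \<longleftrightarrow>
     length w = 2 * n \<and> elevation w (2 * n) = 0 \<and> (\<forall>k \<le> 2 * n. 0 \<le> elevation w k)"
  by (auto simp: dyck_paths_def elevation_def)

text \<open>Parity excludes height 0 at odd abscissae; the bound is the height function of the
  minimum.\<close>

lemma dyck_paths_elevation_ge:
  assumes "w \<in> dyck_paths n" and "k \<le> 2 * n"
  shows "int (k mod 2) \<le> elevation w k"
proof -
  have "0 \<le> elevation w k" "even (elevation w k) \<longleftrightarrow> even k"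
    using assms even_elevation_iff[of k w] by (auto simp: dyck_paths_iff)
  then show ?thesis
    by (cases "elevation w k = 0") (auto simp: mod2_eq_if)
qed

lemma finite_dyck_paths: "finite (dyck_paths n)"
proof -
  have "finite (UNIV :: step set)"
    by (rule finite_subset[of _ "{U, D}"]) (auto intro: step.exhaust)
  then show ?thesis
    by (rule finite_subset[OF _ finite_lists_length_eq[where n = "2 * n"], rotated])
       (auto simp: dyck_paths_def)
qed

section \<open>Order on paths, and paths built from height functions\<close>

lemma weakly_below_iff:
  assumes "v \<in> dyck_paths n" and "w \<in> dyck_paths n"
  shows "weakly_below v w \<longleftrightarrow> (\<forall>k \<le> 2 * n. elevation v k \<le> elevation w k)"
  \<comment> \<open>For \<open>k\<close> past \<open>2 * n\<close> both prefixes are the whole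
    paths, so nothing new is compared there.\<close>
  using assms
  by (auto simp: weakly_below_def dyck_paths_def elevation_def) (metis linorder_le_cases take_all order_refl)

lemma weakly_below_antisym:
  assumes "v \<in> dyck_paths n" and "w \<in> dyck_paths n" and "weakly_below v w" and "weakly_below w v"
  shows "v = w"
proof (rule elevation_eqI)
  show "length v = length w" using assms by (simp add: dyck_paths_iff)
  fix k show "elevation v k = elevation w k"
    using assms(3,4) by (simp add: weakly_below_def elevation_def order_antisym)
qed

text \<open>The step and sign properties characterize height functions; through this lemma pointwise
  minima and maxima become paths.\<close>

lemma dyck_path_of_elevation:
  fixes f :: "nat \<Rightarrow> int"
  assumes "f 0 = 0" and "f (2 * n) = 0" and nonneg: "\<And>k. k \<le> 2 * n \<Longrightarrow> 0 \<le> f k"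
    and step: "\<And>k. k < 2 * n \<Longrightarrow> f (Suc k) = f k + 1 \<or> f (Suc k) = f k - 1"
  obtains w where "w \<in> dyck_paths n" and "\<And>k. k \<le> 2 * n \<Longrightarrow> elevation w k = f k"
proof -
  define w where "w = map (\<lambda>k. if f (Suc k) = f k + 1 then U else D) [0..<2 * n]"
  have el: "elevation w k = f k" if "k \<le> 2 * n" for k
    using that
  proof (induction k)
    case (Suc k)
    with step[of k] show ?case by (auto simp: elevation_Suc w_def)
  qed (simp add: assms(1))
  moreover from el have "w \<in> dyck_paths n"
    using assms(2) nonneg by (auto simp: dyck_paths_iff w_def)
  ultimately show thesis using that by blast
qed

section \<open>Height functions of the minimum and of the join-irreducibles\<close>

lemma elevation_zigzag:
  "elevation (concat (replicate m [U, D])) k = (if k \<le> 2 * m then int (k mod 2) else 0)"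
proof (induction m arbitrary: k)
  case (Suc m)
  consider "k = 0" | "k = 1" | j where "k = Suc (Suc j)"
    by (metis One_nat_def not0_implies_Suc)
  then show ?case
    using Suc.IH by cases (auto simp: elevation_def)
qed (simp add: elevation_def)

lemma elevation_replicate:
  "elevation (replicate m s) k = int (min k m) * (case s of U \<Rightarrow> 1 | D \<Rightarrow> - 1)"
  by (simp add: elevation_def)

lemma elevation_dyck_zero: "k \<le> 2 * n \<Longrightarrow> elevation (dyck_zero n) k = int (k mod 2)"
  by (simp add: dyck_zero_def elevation_zigzag)

lemma dyck_zero_in_dyck_paths: "dyck_zero n \<in> dyck_paths n"
  by (auto simp: dyck_paths_iff elevation_dyck_zero) (simp add: dyck_zero_def)

text \<open>Between zeros at \<open>2 * i\<close> and \<open>2 * i + 2\<close> only a single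
  \<open>U\<close>, \<open>D\<close> fits, so the even abscissae decide.\<close>

lemma eq_dyck_zero_iff:
  assumes "w \<in> dyck_paths n"
  shows "w = dyck_zero n \<longleftrightarrow> (\<forall>i \<le> n. elevation w (2 * i) = 0)"
proof
  assume zero: "\<forall>i \<le> n. elevation w (2 * i) = 0"
  show "w = dyck_zero n"
  proof (rule elevation_eqI)
    show "length w = length (dyck_zero n)"
      using assms dyck_zero_in_dyck_paths by (simp add: dyck_paths_iff)
    fix k assume "k \<le> length (dyck_zero n)"
    then have k: "k \<le> 2 * n" by (simp add: dyck_zero_def)
    have "elevation w k = int (k mod 2)"
    proof (cases "even k")
      case True
      with zero k show ?thesis by auto
    next
      case False
      then obtain i where i: "k = Suc (2 * i)" by (auto elim: oddE)
      moreover have "elevation w (2 * i) = 0" using zero i k by auto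
      ultimately show ?thesis
        using elevation_step[of "2 * i" w] dyck_paths_elevation_ge[OF assms k] k assms
        by (auto simp: dyck_paths_iff)
    qed
    then show "elevation w k = elevation (dyck_zero n) k"
      using k by (simp add: elevation_dyck_zero)
  qed
qed (auto simp: elevation_dyck_zero)

text \<open>The path is the zigzag with one tent laid over it: apex at abscissa
  \<open>a + b\<close>, feet at \<open>2 * (a - 1)\<close> and \<open>2 * b + 2\<close>.\<close>

lemma elevation_join_irr:
  assumes "1 \<le> a" and "a \<le> b" and "b \<le> n - 1" and "k \<le> 2 * n"
  shows "elevation (join_irr n a b) k =
           max (int (k mod 2)) (int b - int a + 2 - \<bar>int k - int (a + b)\<bar>)"
proof -
  define m where "m = b - a + 2"
  define v where "v = concat (replicate (a - 1) [U, D]) @ replicate m U @ replicate m D"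
  have m: "int m = int b - int a + 2" "2 * (a - 1) + m = a + b" "2 * (a - 1) + 2 * m = 2 * b + 2"
    using assms by (simp_all add: m_def)
  have J: "join_irr n a b = v @ concat (replicate (n - 1 - b) [U, D])"
    by (simp add: join_irr_def v_def m_def)
  have v: "length v = 2 * b + 2" "height v = 0"
    using m by (simp_all add: v_def)
  \<comment> \<open>Left zigzag, ascent, descent, right zigzag.\<close>
  consider "k \<le> 2 * (a - 1)" | "2 * (a - 1) < k" "k \<le> a + b" | "a + b < k" "k \<le> 2 * b + 2"
    | "2 * b + 2 < k" by linarith
  then show ?thesis
  proof cases
    case 1
    then have "elevation v k = int (k mod 2)"
      by (simp add: v_def elevation_append elevation_zigzag)
    then show ?thesis using assms v 1 by (simp add: J elevation_append)
  next
    case 2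
    then have "k - 2 * (a - 1) \<le> m" using m by simp
    with 2 have "elevation v k = int (k - 2 * (a - 1))"
      by (simp add: v_def elevation_append elevation_zigzag elevation_replicate)
    moreover have "k mod 2 \<le> k - 2 * (a - 1)"
      using 2 by (auto simp: mod2_eq_if)
    ultimately show ?thesis using assms v 2 by (simp add: J elevation_append)
  next
    case 3
    then have "2 * (a - 1) + m < k" "k - 2 * (a - 1) - m \<le> m" using m by simp_all
    then have "elevation v k = int m - int (k - 2 * (a - 1) - m)"
      by (simp add: v_def elevation_append elevation_zigzag elevation_replicate)
    then have "elevation v k = int (2 * b + 2 - k)" using 3 m by simp
    moreover have "k mod 2 \<le> 2 * b + 2 - k"
      using 3 by (cases "k = 2 * b + 2") (auto simp: mod2_eq_if)
    ultimately show ?thesis using assms v 3 by (simp add: J elevation_append)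
  next
    case 4
    have "(k - (2 * b + 2)) mod 2 = k mod 2"
      using 4 by (simp add: mod2_eq_if)
    moreover have "k - (2 * b + 2) \<le> 2 * (n - 1 - b)" using assms 4 by simp
    ultimately have "elevation (join_irr n a b) k = int (k mod 2)"
      using 4 v by (simp add: J elevation_append elevation_zigzag)
    then show ?thesis using assms 4 by simp
  qed
qed

lemma join_irr_in_dyck_paths:
  assumes "1 \<le> a" and "a \<le> b" and "b \<le> n - 1"
  shows "join_irr n a b \<in> dyck_paths n"
proof -
  have "length (join_irr n a b) = 2 * n"
    using assms by (simp add: join_irr_def)
  then show ?thesis
    using assms by (auto simp: dyck_paths_iff elevation_join_irr)
qed

text \<open>Only the apex matters: heights change by at most one per step, so a path reaching the
  apex stays above the whole tent, and the zigzag lies below every Dyck path.\<close>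

lemma join_irr_below_iff:
  assumes "w \<in> dyck_paths n" and "1 \<le> a" and "a \<le> b" and "b \<le> n - 1"
  shows "weakly_below (join_irr n a b) w \<longleftrightarrow> int b - int a + 2 \<le> elevation w (a + b)"
proof -
  have ab: "a + b \<le> 2 * n" using assms by linarith
  have "weakly_below (join_irr n a b) w \<longleftrightarrow>
      (\<forall>k \<le> 2 * n. max (int (k mod 2)) (int b - int a + 2 - \<bar>int k - int (a + b)\<bar>) \<le> elevation w k)"
    using assms by (simp add: weakly_below_iff[OF join_irr_in_dyck_paths] elevation_join_irr)
  also have "\<dots> \<longleftrightarrow> int b - int a + 2 \<le> elevation w (a + b)"
  proof
    assume "\<forall>k \<le> 2 * n. max (int (k mod 2)) (int b - int a + 2 - \<bar>int k - int (a + b)\<bar>) \<le> elevation w k"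
    with ab show "int b - int a + 2 \<le> elevation w (a + b)" by fastforce
  next
    assume *: "int b - int a + 2 \<le> elevation w (a + b)"
    have "int b - int a + 2 - \<bar>int k - int (a + b)\<bar> \<le> elevation w k" if "k \<le> 2 * n" for k
      using * elevation_lipschitz[of "a + b" w k] assms(1) that ab by (simp add: dyck_paths_iff)
    then show "\<forall>k \<le> 2 * n. max (int (k mod 2)) (int b - int a + 2 - \<bar>int k - int (a + b)\<bar>) \<le> elevation w k"
      using dyck_paths_elevation_ge[OF assms(1)] by auto
  qed
  finally show ?thesis .
qed

section \<open>Meets and joins are pointwise\<close>

lemma meet_dyck_lattice:
  assumes "v \<in> dyck_paths n" and "w \<in> dyck_paths n"
  shows "v \<sqinter>\<^bsub>dyck_lattice n\<^esub> w \<in> dyck_paths n"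
    and "k \<le> 2 * n \<Longrightarrow>
      elevation (v \<sqinter>\<^bsub>dyck_lattice n\<^esub> w) k = min (elevation v k) (elevation w k)"
proof -
  let ?L = "dyck_lattice n"
  have "min (elevation v (Suc k)) (elevation w (Suc k)) = min (elevation v k) (elevation w k) + 1 \<or>
      min (elevation v (Suc k)) (elevation w (Suc k)) = min (elevation v k) (elevation w k) - 1"
    if "k < 2 * n" for k
  proof -
    \<comment> \<open>By parity the two heights are equal or at least 2 apart, so the lower path is
      still weakly lower one step later.\<close>
    have "even (elevation v k) \<longleftrightarrow> even (elevation w k)"
      using that assms by (simp add: even_elevation_iff dyck_paths_iff)
    then have "elevation v k + 1 \<noteq> elevation w k" "elevation w k + 1 \<noteq> elevation v k"
      by (metis even_plus_one_iff)+
    then have "elevation v k = elevation w k \<or> elevation v k + 2 \<le> elevation w k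
        \<or> elevation w k + 2 \<le> elevation v k" by linarith
    then show ?thesis
      using elevation_step[of k v] elevation_step[of k w] that assms
      by (auto simp: dyck_paths_iff)
  qed
  then obtain m where m: "m \<in> dyck_paths n"
    and el: "\<And>k. k \<le> 2 * n \<Longrightarrow> elevation m k = min (elevation v k) (elevation w k)"
    using assms
    by (elim dyck_path_of_elevation[where f = "\<lambda>k. min (elevation v k) (elevation w k)", rotated -1])
       (auto simp: dyck_paths_iff)
  have "greatest ?L m (Lower ?L {v, w})"
    using m assms
    by (auto simp: greatest_def Lower_def dyck_lattice_def weakly_below_iff el)
  \<comment> \<open>\<open>inf\<close> picks some greatest lower bound, so uniqueness is needed to
    identify it with \<open>m\<close>.\<close>
  moreover have "x = m" if "greatest ?L x (Lower ?L {v, w})" for x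
    using that calculation
    by (auto simp: greatest_def dyck_lattice_def Lower_def intro: weakly_below_antisym)
  ultimately have "v \<sqinter>\<^bsub>?L\<^esub> w = m"
    unfolding meet_def inf_def by (rule some_equality)
  with m el show "v \<sqinter>\<^bsub>?L\<^esub> w \<in> dyck_paths n"
    and "k \<le> 2 * n \<Longrightarrow> elevation (v \<sqinter>\<^bsub>?L\<^esub> w) k = min (elevation v k) (elevation w k)"
    by simp_all
qed

lemma join_dyck_lattice:
  assumes "S \<subseteq> dyck_paths n" and "S \<noteq> {}"
  shows "\<Squnion>\<^bsub>dyck_lattice n\<^esub>S \<in> dyck_paths n"
    and "k \<le> 2 * n \<Longrightarrow> elevation (\<Squnion>\<^bsub>dyck_lattice n\<^esub>S) k = (MAX v\<in>S. elevation v k)"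
proof -
  let ?L = "dyck_lattice n" and ?f = "\<lambda>k. MAX v\<in>S. elevation v k"
  have fin: "finite S" using assms(1) finite_dyck_paths by (rule finite_subset)
  have ge: "elevation v k \<le> ?f k" if "v \<in> S" for v k
    using fin that by simp
  have attained: "\<exists>v\<in>S. ?f k = elevation v k" for k
    using Max_in[of "(\<lambda>v. elevation v k) ` S"] fin assms(2) by (metis finite_imageI imageE image_is_empty)
  \<comment> \<open>A path attaining the maximum at \<open>k\<close> limits the fall, one attaining
    it at \<open>Suc k\<close> limits the rise, and parity excludes equality.\<close>
  have "?f (Suc k) = ?f k + 1 \<or> ?f (Suc k) = ?f k - 1" if "k < 2 * n" for k
  proof -
    obtain v where v: "v \<in> S" "?f k = elevation v k" using attained by blast
    obtain w where w: "w \<in> S" "?f (Suc k) = elevation w (Suc k)" using attained by blast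
    have len: "length v = 2 * n" "length w = 2 * n"
      using v w assms(1) by (auto simp: dyck_paths_iff)
    have "even (elevation v k) \<longleftrightarrow> \<not> even (elevation w (Suc k))"
      using that len even_elevation_iff[of k v] even_elevation_iff[of "Suc k" w] by simp
    then have "elevation w (Suc k) \<noteq> elevation v k" by auto
    moreover have "elevation v (Suc k) \<le> elevation w (Suc k)" "elevation w k \<le> elevation v k"
      using ge[of v "Suc k"] ge[of w k] v w by simp_all
    ultimately show ?thesis
      using elevation_step[of k v] elevation_step[of k w] that len v(2) w(2) by auto
  qed
  moreover have "0 \<le> ?f k" if "k \<le> 2 * n" for k
    using attained[of k] assms(1) that by (auto simp: dyck_paths_iff)
  moreover have "?f 0 = 0" "?f (2 * n) = 0"
    using attained[of 0] attained[of "2 * n"] assms(1) by (auto simp: dyck_paths_iff)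
  ultimately obtain m where m: "m \<in> dyck_paths n"
    and el: "\<And>k. k \<le> 2 * n \<Longrightarrow> elevation m k = ?f k"
    by (elim dyck_path_of_elevation[where f = ?f, rotated -1]) auto
  have upper: "weakly_below v m" if "v \<in> S" for v
    using that assms(1) m ge by (auto simp: weakly_below_iff el subset_iff)
  have "weakly_below m x" if "x \<in> dyck_paths n" "\<And>v. v \<in> S \<Longrightarrow> weakly_below v x" for x
    unfolding weakly_below_iff[OF m that(1)]
  proof (intro allI impI)
    fix k assume k: "k \<le> 2 * n"
    obtain v where "v \<in> S" "?f k = elevation v k" using attained by blast
    moreover from this that(2)[of v] have "elevation v k \<le> elevation x k"
      by (simp add: weakly_below_def elevation_def)
    ultimately show "elevation m k \<le> elevation x k"
      using k by (simp add: el)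
  qed
  with m upper assms(1) have "least ?L m (Upper ?L S)"
    by (fastforce simp: least_def Upper_def dyck_lattice_def)
  moreover have "x = m" if "least ?L x (Upper ?L S)" for x
    using that calculation
    by (auto simp: least_def dyck_lattice_def Upper_def intro: weakly_below_antisym)
  ultimately have "\<Squnion>\<^bsub>?L\<^esub>S = m"
    unfolding sup_def by (rule some_equality)
  with m el show "\<Squnion>\<^bsub>?L\<^esub>S \<in> dyck_paths n"
    and "k \<le> 2 * n \<Longrightarrow> elevation (\<Squnion>\<^bsub>?L\<^esub>S) k = ?f k"
    by simp_all
qed

section \<open>The pseudocomplement\<close>

text \<open>A nonzero height at \<open>2 * i\<close> is at least 2 on a Dyck path, so the atom of
  order \<open>i\<close> lies below. The range includes 0 and \<open>n\<close>, which never qualify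
  and so count as zeros.\<close>

definition atom_orders :: "nat \<Rightarrow> step list \<Rightarrow> nat set" where
  "atom_orders n w = {i. i \<le> n \<and> elevation w (2 * i) \<noteq> 0}"

text \<open>Meets are pointwise minima of nonnegative heights, so a trivial meet becomes
  disjointness of sets of atoms.\<close>

lemma meet_eq_dyck_zero_iff:
  assumes "v \<in> dyck_paths n" and "w \<in> dyck_paths n"
  shows "v \<sqinter>\<^bsub>dyck_lattice n\<^esub> w = dyck_zero n \<longleftrightarrow> atom_orders n v \<inter> atom_orders n w = {}"
proof -
  have "min (elevation v (2 * i)) (elevation w (2 * i)) = 0 \<longleftrightarrow>
      elevation v (2 * i) = 0 \<or> elevation w (2 * i) = 0" if "i \<le> n" for i
  proof -
    have "0 \<le> elevation v (2 * i)" "0 \<le> elevation w (2 * i)"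
      using assms that by (auto simp: dyck_paths_iff)
    then show ?thesis by linarith
  qed
  then show ?thesis
    using assms
    by (auto simp: eq_dyck_zero_iff[OF meet_dyck_lattice(1)] meet_dyck_lattice(2) atom_orders_def)
qed

lemma atom_orders_subset:
  assumes "w \<in> dyck_paths n"
  shows "atom_orders n w \<subseteq> {1..n - 1}"
proof
  fix i assume "i \<in> atom_orders n w"
  then have "i \<le> n" "elevation w (2 * i) \<noteq> 0" by (auto simp: atom_orders_def)
  moreover have "elevation w (2 * n) = 0" "elevation w (2 * 0) = 0"
    using assms by (simp_all add: dyck_paths_iff)
  ultimately have "i \<le> n" "i \<noteq> n" "i \<noteq> 0" by metis+
  then show "i \<in> {1..n - 1}" by auto
qed

lemma atom_orders_join_irr:
  assumes "1 \<le> a" and "a \<le> b" and "b \<le> n - 1"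
  shows "atom_orders n (join_irr n a b) = {a..b}"
  using assms by (auto simp: atom_orders_def elevation_join_irr)

text \<open>The join is a pointwise maximum over a finite nonempty set, so a nonzero height at
  \<open>2 * i\<close> already occurs in one joined path, whose atoms avoid those of
  \<open>P\<close>. Thus the join itself belongs to the set being joined.\<close>

lemma pseudocomplement_properties:
  assumes "P \<in> dyck_paths n"
  shows "pseudocomplement n P \<in> dyck_paths n"
    and "atom_orders n P \<inter> atom_orders n (pseudocomplement n P) = {}"
    and "\<lbrakk>w \<in> dyck_paths n; atom_orders n P \<inter> atom_orders n w = {}\<rbrakk>
           \<Longrightarrow> weakly_below w (pseudocomplement n P)"
proof -
  define S where "S = {w \<in> dyck_paths n. atom_orders n P \<inter> atom_orders n w = {}}"
  have pc: "pseudocomplement n P = \<Squnion>\<^bsub>dyck_lattice n\<^esub>S"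
    unfolding pseudocomplement_def S_def
    by (simp add: meet_eq_dyck_zero_iff[OF assms] cong: conj_cong)
  have "dyck_zero n \<in> S"
    by (auto simp: S_def dyck_zero_in_dyck_paths atom_orders_def elevation_dyck_zero)
  then have S: "S \<subseteq> dyck_paths n" "S \<noteq> {}" by (auto simp: S_def)
  have fin: "finite S" using S(1) finite_dyck_paths by (rule finite_subset)
  show pcD: "pseudocomplement n P \<in> dyck_paths n"
    unfolding pc by (rule join_dyck_lattice(1)[OF S])
  show "weakly_below w (pseudocomplement n P)"
    if "w \<in> dyck_paths n" "atom_orders n P \<inter> atom_orders n w = {}"
  proof -
    have "w \<in> S" using that by (simp add: S_def)
    then show ?thesis
      unfolding weakly_below_iff[OF that(1) pcD] unfolding pc
      using fin by (simp add: join_dyck_lattice(2)[OF S])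
  qed
  show "atom_orders n P \<inter> atom_orders n (pseudocomplement n P) = {}"
  proof safe
    fix i assume i: "i \<in> atom_orders n P" "i \<in> atom_orders n (pseudocomplement n P)"
    then have "(MAX v\<in>S. elevation v (2 * i)) \<noteq> 0"
      by (auto simp: atom_orders_def pc join_dyck_lattice(2)[OF S])
    moreover have "(MAX v\<in>S. elevation v (2 * i)) \<in> (\<lambda>v. elevation v (2 * i)) ` S"
      using fin S(2) by (intro Max_in) simp_all
    then obtain v where "v \<in> S" "(MAX v\<in>S. elevation v (2 * i)) = elevation v (2 * i)"
      by (elim imageE)
    ultimately show "i \<in> {}"
      using i(1) by (auto simp: S_def atom_orders_def)
  qed
qed

text \<open>The atoms below a join-irreducible are those of its interval: below the pseudocomplement
  they must avoid those of \<open>P\<close>, and if they do, the join-irreducible is among the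
  joined paths.\<close>

lemma intervals_below_pseudocomplement:
  assumes "P \<in> dyck_paths n"
  shows "intervals_below n (pseudocomplement n P) =
    {{a..b} | a b. 1 \<le> a \<and> a \<le> b \<and> b \<le> n - 1 \<and> atom_orders n P \<inter> {a..b} = {}}"
proof -
  let ?Q = "pseudocomplement n P"
  note pc = pseudocomplement_properties[OF assms]
  have "weakly_below (join_irr n a b) ?Q \<longleftrightarrow> atom_orders n P \<inter> {a..b} = {}"
    if ab: "1 \<le> a" "a \<le> b" "b \<le> n - 1" for a b
  proof
    assume *: "weakly_below (join_irr n a b) ?Q"
    have "{a..b} \<subseteq> atom_orders n ?Q"
    proof
      fix i assume "i \<in> {a..b}"
      then have "i \<in> atom_orders n (join_irr n a b)" using ab by (simp add: atom_orders_join_irr)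
      then have i: "i \<le> n" "elevation (join_irr n a b) (2 * i) \<noteq> 0" by (auto simp: atom_orders_def)
      moreover have "0 \<le> elevation (join_irr n a b) (2 * i)"
        using join_irr_in_dyck_paths[OF ab] i(1) by (auto simp: dyck_paths_iff)
      moreover have "elevation (join_irr n a b) (2 * i) \<le> elevation ?Q (2 * i)"
        using * by (simp add: weakly_below_def elevation_def)
      ultimately show "i \<in> atom_orders n ?Q" by (auto simp: atom_orders_def)
    qed
    with pc(2) show "atom_orders n P \<inter> {a..b} = {}" by blast
  next
    assume "atom_orders n P \<inter> {a..b} = {}"
    then show "weakly_below (join_irr n a b) ?Q"
      using ab by (intro pc(3)) (auto simp: atom_orders_join_irr join_irr_in_dyck_paths)
  qed
  then show ?thesis
    by (simp add: intervals_below_def cong: conj_cong)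
qed

section \<open>Peaks and representing intervals\<close>

lemma atLeastAtMost_in_intervals_below_iff:
  assumes "P \<in> dyck_paths n" and "1 \<le> a" and "a \<le> b" and "b \<le> n - 1"
  shows "{a..b} \<in> intervals_below n P \<longleftrightarrow> int b - int a + 2 \<le> elevation P (a + b)"
proof -
  have "{a..b} \<in> intervals_below n P \<longleftrightarrow> weakly_below (join_irr n a b) P"
    using assms(2-) by (auto simp: intervals_below_def Icc_eq_Icc)
  then show ?thesis using assms by (simp add: join_irr_below_iff)
qed

text \<open>Adding one element at either end moves the apex one abscissa sideways and one unit up.
  Maximality excludes both moves, which together with parity leaves exactly a peak.\<close>

lemma atLeastAtMost_in_max_intervals_iff:
  assumes P: "P \<in> dyck_paths n" and a: "1 \<le> a" and ab: "a \<le> b" and b: "b \<le> n - 1"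
  shows "{a..b} \<in> max_intervals n P \<longleftrightarrow>
    elevation P (a + b - 1) = int b - int a + 1 \<and> elevation P (a + b) = int b - int a + 2 \<and>
    elevation P (a + b + 1) = int b - int a + 1"
    (is "_ \<longleftrightarrow> ?peak")
proof
  assume max: "{a..b} \<in> max_intervals n P"
  have len: "length P = 2 * n" using P by (simp add: dyck_paths_iff)
  have step1: "elevation P (a + b) = elevation P (a + b - 1) + 1 \<or>
      elevation P (a + b) = elevation P (a + b - 1) - 1"
    using elevation_step[of "a + b - 1" P] a ab b len by simp
  have step2: "elevation P (a + b + 1) = elevation P (a + b) + 1 \<or>
      elevation P (a + b + 1) = elevation P (a + b) - 1"
    using elevation_step[of "a + b" P] a ab b len by simp
  from max have "{a..b} \<in> intervals_below n P" by (simp add: max_intervals_def)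
  then have ge: "int b - int a + 2 \<le> elevation P (a + b)"
    using assms by (simp add: atLeastAtMost_in_intervals_below_iff)
  have maximal: "K = {a..b}" if "K \<in> intervals_below n P" "{a..b} \<subseteq> K" for K
    using max that by (simp add: max_intervals_def)
  have left: "elevation P (a + b - 1) < int b - int a + 3"
  proof (cases "a = 1")
    case True
    have "b \<le> 2 * n" using b by linarith
    then have "elevation P b \<le> int b"
      using elevation_lipschitz[of 0 P b] len by simp
    then show ?thesis using True by simp
  next
    case False
    then have "{a - 1..b} \<noteq> {a..b}" "{a..b} \<subseteq> {a - 1..b}" using ab a by (simp_all add: Icc_eq_Icc)
    with maximal[of "{a - 1..b}"] have "{a - 1..b} \<notin> intervals_below n P" by argo
    moreover have "1 \<le> a - 1" "a - 1 \<le> b" "a - 1 + b = a + b - 1" using False a ab by auto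
    ultimately show ?thesis
      using atLeastAtMost_in_intervals_below_iff[OF P, of "a - 1" b] a b by (simp add: of_nat_diff)
  qed
  \<comment> \<open>Symmetric; for \<open>b = n - 1\<close> the bound comes from the distance to the
    end of the path.\<close>
  have right: "elevation P (a + b + 1) < int b - int a + 3"
  proof (cases "b = n - 1")
    case True
    then have "elevation P (a + b + 1) \<le> int (n - a)"
      using elevation_lipschitz[of "2 * n" P "a + b + 1"] a ab P by (auto simp: dyck_paths_iff)
    then show ?thesis using True a ab by simp
  next
    case False
    then have "{a..b + 1} \<noteq> {a..b}" "{a..b} \<subseteq> {a..b + 1}" using ab a by (simp_all add: Icc_eq_Icc)
    with maximal[of "{a..b + 1}"] have "{a..b + 1} \<notin> intervals_below n P" by argo
    then show ?thesis
      using atLeastAtMost_in_intervals_below_iff[OF P, of a "b + 1"] a b ab False by simp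
  qed
  have "even (elevation P (a + b)) \<longleftrightarrow> even (a + b)"
    using even_elevation_iff[of "a + b" P] a ab b len by simp
  then have "elevation P (a + b) \<noteq> int b - int a + 3" by auto
  with ge left right step1 step2 show ?peak by linarith
next
  assume peak: ?peak
  have len: "length P = 2 * n" using P by (simp add: dyck_paths_iff)
  show "{a..b} \<in> max_intervals n P"
    unfolding max_intervals_def
  proof (intro CollectI conjI ballI impI)
    show "{a..b} \<in> intervals_below n P"
      using assms peak by (simp add: atLeastAtMost_in_intervals_below_iff)
    fix K assume K: "K \<in> intervals_below n P" "{a..b} \<subseteq> K"
    then obtain c d where cd: "K = {c..d}" "1 \<le> c" "c \<le> d" "d \<le> n - 1"
      by (auto simp: intervals_below_def)
    then have le: "int d - int c + 2 \<le> elevation P (c + d)"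
      using K(1) P by (simp add: atLeastAtMost_in_intervals_below_iff)
    have sub: "c \<le> a" "b \<le> d" using K(2) cd(1) ab by auto
    have "c + d \<le> 2 * n" "a + b + 1 \<le> 2 * n" "a + b - 1 \<le> 2 * n" using cd b ab by auto
    \<comment> \<open>Measuring from the feet of the peak instead of its top improves the bound by
      2, which is what makes \<open>c + d \<noteq> a + b\<close> contradictory.\<close>
    then have l: "\<bar>elevation P (c + d) - elevation P (a + b - 1)\<bar> \<le> \<bar>int (c + d) - int (a + b - 1)\<bar>"
      and r: "\<bar>elevation P (c + d) - elevation P (a + b + 1)\<bar> \<le> \<bar>int (c + d) - int (a + b + 1)\<bar>"
      unfolding len[symmetric] by (blast intro: elevation_lipschitz)+
    have "c + d = a + b"
    proof (rule linorder_cases)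
      assume "c + d < a + b"
      then have "elevation P (c + d) \<le> int b - int a + 1 + (int a + int b - 1 - int c - int d)"
        using l peak a by simp
      with le sub show ?thesis by linarith
    next
      assume "a + b < c + d"
      then have "elevation P (c + d) \<le> int b - int a + 1 + (int c + int d - int a - int b - 1)"
        using r peak by simp
      with le sub show ?thesis by linarith
    qed
    moreover from this peak le have "int d - int c \<le> int b - int a" by simp
    ultimately have "c = a" "d = b" using sub by linarith+
    with cd(1) show "K = {a..b}" by simp
  qed
qed

text \<open>
  A peak is indexed, as in \<^const>\<open>num_peaks\<close>, by the position \<open>i\<close> of its up step, so its height is
  \<open>elevation P i + 1\<close>.
\<close>

definition high_peaks :: "nat \<Rightarrow> step list \<Rightarrow> nat set" where
  "high_peaks n P = {i. Suc i < 2 * n \<and> 0 < elevation P i \<and>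
     elevation P (Suc i) = elevation P i + 1 \<and> elevation P (Suc (Suc i)) = elevation P i}"

text \<open>The abscissa of the peak gives \<open>a + b\<close> and its height gives
  \<open>b - a\<close>, so the peak determines the interval. \<open>Min I + Max I - 1\<close> is the
  position of its up step.\<close>

lemma card_max_intervals:
  assumes P: "P \<in> dyck_paths n"
  shows "card (max_intervals n P) = card (high_peaks n P)"
proof (rule bij_betw_same_card[of "\<lambda>I. Min I + Max I - 1"], unfold bij_betw_def, intro conjI)
  have I: "\<exists>a b. I = {a..b} \<and> 1 \<le> a \<and> a \<le> b \<and> b \<le> n - 1 \<and> Min I + Max I - 1 = a + b - 1 \<and>
      elevation P (a + b - 1) = int b - int a + 1 \<and> elevation P (a + b) = int b - int a + 2 \<and>
      elevation P (a + b + 1) = int b - int a + 1" if "I \<in> max_intervals n P" for I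
  proof -
    from that obtain a b where ab: "I = {a..b}" "1 \<le> a" "a \<le> b" "b \<le> n - 1"
      by (auto simp: max_intervals_def intervals_below_def)
    moreover have "Min I = a" "Max I = b" using ab by (auto intro: Min_eqI Max_eqI)
    ultimately show ?thesis
      using that P by (intro exI[of _ a] exI[of _ b]) (simp add: atLeastAtMost_in_max_intervals_iff)
  qed
  show "inj_on (\<lambda>I. Min I + Max I - 1) (max_intervals n P)"
  proof (rule inj_onI)
    fix I K
    assume "I \<in> max_intervals n P" "K \<in> max_intervals n P" and eq: "Min I + Max I - 1 = Min K + Max K - 1"
    from I[OF this(1)] obtain a b where ab: "I = {a..b}" "1 \<le> a" "Min I + Max I - 1 = a + b - 1"
      "elevation P (a + b - 1) = int b - int a + 1" by blast
    from I[OF \<open>K \<in> _\<close>] obtain c d where cd: "K = {c..d}" "1 \<le> c" "Min K + Max K - 1 = c + d - 1"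
      "elevation P (c + d - 1) = int d - int c + 1" by blast
    have "a + b - 1 = c + d - 1" using eq ab(3) cd(3) by simp
    with ab(4) cd(4) have "int b - int a = int d - int c" by simp
    with \<open>a + b - 1 = c + d - 1\<close> ab(2) cd(2) have "a = c" "b = d" by linarith+
    then show "I = K" using ab(1) cd(1) by simp
  qed
  show "(\<lambda>I. Min I + Max I - 1) ` max_intervals n P = high_peaks n P"
  proof (intro equalityI subsetI)
    fix i assume "i \<in> (\<lambda>I. Min I + Max I - 1) ` max_intervals n P"
    then obtain K where "K \<in> max_intervals n P" "i = Min K + Max K - 1" by auto
    with I obtain a b where ab: "1 \<le> a" "a \<le> b" "b \<le> n - 1" "i = a + b - 1"
      "elevation P (a + b - 1) = int b - int a + 1" "elevation P (a + b) = int b - int a + 2"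
      "elevation P (a + b + 1) = int b - int a + 1" by metis
    moreover have "Suc i = a + b" "Suc (Suc i) = a + b + 1" using ab(1,4) by simp_all
    ultimately show "i \<in> high_peaks n P"
      unfolding high_peaks_def mem_Collect_eq by auto
  next
    fix i assume "i \<in> high_peaks n P"
    then have i: "Suc i < 2 * n" "0 < elevation P i" "elevation P (Suc i) = elevation P i + 1"
      "elevation P (Suc (Suc i)) = elevation P i" by (auto simp: high_peaks_def)
    \<comment> \<open>Solving \<open>a + b - 1 = i\<close> and \<open>b - a + 1 = q\<close> gives
      \<open>a = c + 1\<close> and \<open>b = c + q\<close> with
      \<open>i = q + 2 * c\<close>.\<close>
    define q where "q = nat (elevation P i)"
    have q: "elevation P i = int q" "1 \<le> q" using i(2) by (auto simp: q_def)
    have len: "length P = 2 * n" "elevation P (2 * n) = 0" using P by (auto simp: dyck_paths_iff)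
    have "q \<le> i" using elevation_lipschitz[of 0 P i] i(1) len q by simp
    moreover have "even q \<longleftrightarrow> even i" using even_elevation_iff[of i P] i(1) len q by simp
    ultimately obtain c where c: "i = q + 2 * c"
      by (metis even_diff_nat dvdE le_add_diff_inverse even_add)
    \<comment> \<open>From height \<open>q + 1\<close> at \<open>Suc i\<close>, at least
      \<open>q + 1\<close> steps are needed to reach the axis; this yields
      \<open>b \<le> n - 1\<close>.\<close>
    have "q + i + 2 \<le> 2 * n"
      using elevation_lipschitz[of "2 * n" P "Suc i"] i(1,3) len q by simp
    then have bounds: "1 \<le> c + 1" "c + 1 \<le> c + q" "c + q \<le> n - 1" using q c by auto
    have "c + 1 + (c + q) - 1 = i" "c + 1 + (c + q) = Suc i" "Suc i + 1 = Suc (Suc i)"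
      using c by simp_all
    then have "{c + 1..c + q} \<in> max_intervals n P"
      using i q unfolding atLeastAtMost_in_max_intervals_iff[OF P bounds] by simp
    moreover have "Min {c + 1..c + q} = c + 1" "Max {c + 1..c + q} = c + q"
      using q(2) by (auto intro: Min_eqI Max_eqI)
    then have "i = Min {c + 1..c + q} + Max {c + 1..c + q} - 1" using c by simp
    ultimately show "i \<in> (\<lambda>I. Min I + Max I - 1) ` max_intervals n P" by (rule rev_image_eqI)
  qed
qed

text \<open>Peaks are split by the height of their feet: feet on the axis are at even abscissae
  \<open>2 * j\<close> and \<open>2 * j + 2\<close>. As \<open>Suc j \<le> n\<close>, absence from
  \<open>atom_orders\<close> does mean height 0.\<close>

lemma num_peaks_eq:
  assumes P: "P \<in> dyck_paths n"
  shows "num_peaks P = card (high_peaks n P) +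
    card {j. j < n \<and> j \<notin> atom_orders n P \<and> Suc j \<notin> atom_orders n P}"
proof -
  let ?low = "{j. j < n \<and> j \<notin> atom_orders n P \<and> Suc j \<notin> atom_orders n P}"
  have len: "length P = 2 * n" using P by (simp add: dyck_paths_iff)
  have nonneg: "0 \<le> elevation P k" if "k \<le> 2 * n" for k using P that by (simp add: dyck_paths_iff)
  have peak: "P ! i = U \<and> P ! Suc i = D \<longleftrightarrow>
      elevation P (Suc i) = elevation P i + 1 \<and> elevation P (Suc (Suc i)) = elevation P i"
    if "Suc i < 2 * n" for i
    using that len nth_eq_U_iff[of i P] nth_eq_D_iff[of "Suc i" P] by auto
  have "{i. Suc i < length P \<and> P ! i = U \<and> P ! Suc i = D} = high_peaks n P \<union> (*) 2 ` ?low"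
  proof (intro equalityI subsetI)
    fix i assume "i \<in> {i. Suc i < length P \<and> P ! i = U \<and> P ! Suc i = D}"
    then have i: "Suc i < 2 * n" "elevation P (Suc i) = elevation P i + 1"
      "elevation P (Suc (Suc i)) = elevation P i" using peak len by auto
    show "i \<in> high_peaks n P \<union> (*) 2 ` ?low"
    proof (cases "elevation P i = 0")
      case True
      then have "even i" using even_elevation_iff[of i P] i(1) len by simp
      then obtain j where j: "i = 2 * j" by (elim evenE)
      then have "j \<in> ?low" using i True by (auto simp: atom_orders_def)
      then show ?thesis using j by auto
    next
      case False
      then show ?thesis using i nonneg[of i] by (auto simp: high_peaks_def)
    qed
  next
    fix i assume "i \<in> high_peaks n P \<union> (*) 2 ` ?low"
    then show "i \<in> {i. Suc i < length P \<and> P ! i = U \<and> P ! Suc i = D}"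
    proof
      assume "i \<in> high_peaks n P"
      then show ?thesis using peak len by (auto simp: high_peaks_def)
    next
      assume "i \<in> (*) 2 ` ?low"
      then have i: "Suc i < 2 * n" "elevation P i = 0" "elevation P (Suc (Suc i)) = 0"
        by (auto simp: atom_orders_def)
      moreover have "elevation P (Suc i) = 1"
        using elevation_step[of i P] nonneg[of "Suc i"] i len by auto
      ultimately show ?thesis using peak[of i] len by auto
    qed
  qed
  moreover have "high_peaks n P \<inter> (*) 2 ` ?low = {}"
    by (auto simp: high_peaks_def atom_orders_def)
  moreover have "finite (high_peaks n P)"
    by (rule finite_subset[of _ "{..<2 * n}"]) (auto simp: high_peaks_def)
  ultimately have "num_peaks P = card (high_peaks n P) + card ((*) 2 ` ?low)"
    by (simp add: num_peaks_def card_Un_disjoint)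
  also have "card ((*) 2 ` ?low) = card ?low"
    by (rule card_image) (auto intro: inj_onI)
  finally show ?thesis .
qed

section \<open>Runs in the complement of a set of integers\<close>

text \<open>Every member of a finite family lies in a maximal one; this replaces the union of the
  representing intervals by that of all intervals below.\<close>

lemma Union_maximal_elements:
  fixes F :: "'a set set"
  assumes "finite F"
  shows "\<Union> {I \<in> F. \<forall>K \<in> F. I \<subseteq> K \<longrightarrow> K = I} = \<Union> F"
proof (intro equalityI subsetI)
  fix x assume "x \<in> \<Union> F"
  then obtain J where "x \<in> J" "J \<in> F" by auto
  with finite_has_maximal2[OF assms, of J] obtain I where "I \<in> F" "J \<subseteq> I" "\<forall>K \<in> F. I \<subseteq> K \<longrightarrow> K = I"
    by blast
  with \<open>x \<in> J\<close> show "x \<in> \<Union> {I \<in> F. \<forall>K \<in> F. I \<subseteq> K \<longrightarrow> K = I}" by blast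
qed auto

text \<open>For \<open>m = n - 1\<close> and \<open>A\<close> the atom orders of \<open>P\<close>,
  these are the intervals below the pseudocomplement.\<close>

definition free_intervals :: "nat \<Rightarrow> nat set \<Rightarrow> nat set set" where
  "free_intervals m A = {{a..b} | a b. 1 \<le> a \<and> a \<le> b \<and> b \<le> m \<and> A \<inter> {a..b} = {}}"

lemma Union_free_intervals: "\<Union> (free_intervals m A) = {1..m} - A"
proof (intro equalityI subsetI)
  fix i assume "i \<in> {1..m} - A"
  then have "{i..i} \<in> free_intervals m A" unfolding free_intervals_def
    by (intro CollectI exI[of _ i]) auto
  then show "i \<in> \<Union> (free_intervals m A)" by auto
qed (auto simp: free_intervals_def)

text \<open>A maximal free interval is stopped on each side by an element of \<open>A\<close> or by
  the end of \<open>{1..m}\<close>; internality excludes the latter.\<close>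

lemma internal_maximal_free_intervals:
  assumes A: "A \<subseteq> {1..m}"
  shows "{I \<in> free_intervals m A. (\<forall>K \<in> free_intervals m A. I \<subseteq> K \<longrightarrow> K = I) \<and> 1 \<notin> I \<and> m \<notin> I} =
    {{i<..<j} | i j. i \<in> A \<and> j \<in> A \<and> Suc i < j \<and> A \<inter> {i<..<j} = {}}"
    (is "?L = ?R")
proof (intro equalityI subsetI)
  fix I assume I: "I \<in> ?L"
  then obtain a b where ab: "I = {a..b}" "1 \<le> a" "a \<le> b" "b \<le> m" "A \<inter> {a..b} = {}"
    by (auto simp: free_intervals_def)
  have max: "K = I" if "K \<in> free_intervals m A" "I \<subseteq> K" for K using I that by blast
  have "1 < a" "b < m" using I ab by (auto simp: le_less)
  have "a - 1 \<in> A"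
  proof (rule ccontr)
    assume "a - 1 \<notin> A"
    moreover have "{a - 1..b} = insert (a - 1) {a..b}" using ab by auto
    ultimately have "A \<inter> {a - 1..b} = {}" using ab(5) by simp
    then have "{a - 1..b} \<in> free_intervals m A"
      using ab \<open>1 < a\<close> unfolding free_intervals_def
      by (intro CollectI exI[of _ "a - 1"] exI[of _ b]) auto
    with max[of "{a - 1..b}"] ab show False by (auto simp: Icc_eq_Icc)
  qed
  moreover have "b + 1 \<in> A"
  proof (rule ccontr)
    assume "b + 1 \<notin> A"
    moreover have "{a..b + 1} = insert (b + 1) {a..b}" using ab by auto
    ultimately have "A \<inter> {a..b + 1} = {}" using ab(5) by simp
    then have "{a..b + 1} \<in> free_intervals m A"
      using ab \<open>b < m\<close> unfolding free_intervals_def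
      by (intro CollectI exI[of _ a] exI[of _ "b + 1"]) auto
    with max[of "{a..b + 1}"] ab show False by (auto simp: Icc_eq_Icc)
  qed
  moreover have "I = {a - 1<..<b + 1}" using ab by auto
  ultimately show "I \<in> ?R" using ab by (intro CollectI exI[of _ "a - 1"] exI[of _ "b + 1"]) auto
next
  fix I assume "I \<in> ?R"
  then obtain i j where ij: "I = {i<..<j}" "i \<in> A" "j \<in> A" "Suc i < j" "A \<inter> {i<..<j} = {}" by blast
  have I: "I = {Suc i..j - 1}" using ij by auto
  have bounds: "1 \<le> i" "j \<le> m" using A ij by auto
  have "I \<in> free_intervals m A"
    using ij(4,5) bounds unfolding free_intervals_def
    by (intro CollectI exI[of _ "Suc i"] exI[of _ "j - 1"]) (auto simp: I ij(1)[symmetric])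
  moreover have "K = I" if "K \<in> free_intervals m A" "I \<subseteq> K" for K
  proof -
    from that(1) obtain c d where cd: "K = {c..d}" "A \<inter> {c..d} = {}"
      by (auto simp: free_intervals_def)
    have "c \<le> Suc i" "j - 1 \<le> d" using that(2) ij(4) by (auto simp: I cd(1))
    moreover have "i \<notin> {c..d}" "j \<notin> {c..d}" using cd(2) ij by auto
    ultimately show ?thesis using ij(4) by (simp add: I cd(1)) linarith
  qed
  ultimately show "I \<in> ?L" using ij(1) bounds by auto
qed

text \<open>The right-hand set consists of the starts of the runs of \<open>A\<close>; there is one
  gap fewer than there are runs.\<close>

lemma card_gaps:
  fixes A :: "nat set"
  assumes fin: "finite A" and "0 \<notin> A" and "A \<noteq> {}"
  shows "Suc (card {{i<..<j} | i j. i \<in> A \<and> j \<in> A \<and> Suc i < j \<and> A \<inter> {i<..<j} = {}}) =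
    card {j \<in> A. j - 1 \<notin> A}" (is "Suc (card ?G) = card ?B")
proof -
  \<comment> \<open>A gap is determined by its right end, which can be any element of \<open>?B\<close> but the least one.\<close>
  define pr where "pr j = Max {i \<in> A. i < j}" for j
  have pr: "pr j \<in> A" "pr j < j" "A \<inter> {pr j<..<j} = {}" if "j \<in> A" "j \<noteq> Min A" for j
  proof -
    have "Min A \<in> {i \<in> A. i < j}"
      using that fin assms(3) by (auto simp: less_le)
    then have "pr j \<in> {i \<in> A. i < j}"
      unfolding pr_def using fin by (intro Max_in) auto
    then show "pr j \<in> A" "pr j < j" by auto
    show "A \<inter> {pr j<..<j} = {}"
    proof (rule ccontr)
      assume "A \<inter> {pr j<..<j} \<noteq> {}"
      then obtain i where "i \<in> A" "i < j" "pr j < i" by auto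
      moreover from this have "i \<le> pr j" unfolding pr_def using fin by (intro Max_ge) auto
      ultimately show False by simp
    qed
  qed
  have "?G = (\<lambda>j. {pr j<..<j}) ` (?B - {Min A})"
  proof (intro equalityI subsetI)
    fix I assume "I \<in> ?G"
    then obtain i j where ij: "I = {i<..<j}" "i \<in> A" "j \<in> A" "Suc i < j" "A \<inter> {i<..<j} = {}" by blast
    have "j \<noteq> Min A" using Min_le[OF fin ij(2)] ij(4) by auto
    moreover have "j - 1 \<in> {i<..<j}" using ij(4) by auto
    then have "j - 1 \<notin> A" using ij(5) by blast
    moreover have "pr j = i"
      unfolding pr_def using ij fin by (intro Max_eqI) (auto simp: not_less[symmetric])
    ultimately show "I \<in> (\<lambda>j. {pr j<..<j}) ` (?B - {Min A})" using ij by auto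
  next
    fix I assume "I \<in> (\<lambda>j. {pr j<..<j}) ` (?B - {Min A})"
    then obtain j where j: "I = {pr j<..<j}" "j \<in> A" "j - 1 \<notin> A" "j \<noteq> Min A" by auto
    have "pr j \<noteq> j - 1" using pr(1)[OF j(2,4)] j(3) by auto
    then have "Suc (pr j) < j" using pr(2)[OF j(2,4)] by auto
    then show "I \<in> ?G" using pr[OF j(2,4)] j by blast
  qed
  moreover have "inj_on (\<lambda>j. {pr j<..<j}) (?B - {Min A})"
  proof (rule inj_onI)
    \<comment> \<open>The gap is nonempty because \<open>j - 1\<close> is not in \<open>A\<close>,
      so its maximum recovers \<open>j\<close>.\<close>
    have Max: "Max {pr j<..<j} = j - 1" "0 < j" if "j \<in> ?B - {Min A}" for j
    proof -
      have "pr j \<noteq> j - 1" "pr j < j" using pr[of j] that by auto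
      then show "Max {pr j<..<j} = j - 1" "0 < j" by (auto intro!: Max_eqI)
    qed
    fix j k assume "j \<in> ?B - {Min A}" "k \<in> ?B - {Min A}" "{pr j<..<j} = {pr k<..<k}"
    then show "j = k" using Max[of j] Max[of k] by simp
  qed
  ultimately have "card ?G = card (?B - {Min A})" by (simp add: card_image)
  \<comment> \<open>With \<open>0 \<notin> A\<close> the truncated \<open>Min A - 1\<close> is
    strictly smaller than the minimum, hence outside \<open>A\<close>.\<close>
  moreover have "Min A \<in> ?B"
  proof -
    have M: "Min A \<in> A" using fin assms(3) by simp
    then have "Min A \<noteq> 0" using assms(2) by metis
    then have "Min A - 1 \<notin> A" using Min_le[OF fin, of "Min A - 1"] by auto
    with M show ?thesis by simp
  qed
  ultimately show ?thesis using fin card.remove[of ?B "Min A"] by simp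
qed

text \<open>The free \<open>k < n\<close> are split by whether \<open>Suc k\<close> is free; if not,
  \<open>Suc k\<close> starts a run of \<open>A\<close>.\<close>

lemma card_adjacent_free_pairs:
  assumes A: "A \<subseteq> {1..n - 1}"
  shows "card {k. k < n \<and> k \<notin> A \<and> Suc k \<notin> A} + card {j \<in> A. j - 1 \<notin> A} = card ({..<n} - A)"
proof -
  have "card {j \<in> A. j - 1 \<notin> A} = card {k. k < n \<and> k \<notin> A \<and> Suc k \<in> A}"
  proof (rule bij_betw_same_card[symmetric])
    show "bij_betw Suc {k. k < n \<and> k \<notin> A \<and> Suc k \<in> A} {j \<in> A. j - 1 \<notin> A}"
      using A by (intro bij_betw_byWitness[where f' = "\<lambda>j. j - 1"]) force+
  qed
  moreover have "{..<n} - A = {k. k < n \<and> k \<notin> A \<and> Suc k \<notin> A} \<union> {k. k < n \<and> k \<notin> A \<and> Suc k \<in> A}"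
    by auto
  then have "card ({..<n} - A) = card {k. k < n \<and> k \<notin> A \<and> Suc k \<notin> A}
      + card {k. k < n \<and> k \<notin> A \<and> Suc k \<in> A}"
    by (simp only:) (rule card_Un_disjoint, auto)
  ultimately show ?thesis by simp
qed

theorem proposition5p1:
  fixes n :: nat and P :: "step list"
  assumes "P \<in> dyck_paths n"
    and "P \<noteq> dyck_zero n"
  shows "int (num_peaks P) =
           int (card (max_intervals n P))
         + int (card (\<Union> (max_intervals n (pseudocomplement n P))))
         - int (card (internal_intervals n (pseudocomplement n P)))"
proof -
  define A where "A = atom_orders n P"
  let ?F = "free_intervals (n - 1) A" and ?Q = "pseudocomplement n P"
  have A: "A \<subseteq> {1..n - 1}" unfolding A_def by (rule atom_orders_subset[OF assms(1)])
  then have fin: "finite A" "0 \<notin> A" by (auto intro: finite_subset)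
  have ne: "A \<noteq> {}"
    using assms by (auto simp: eq_dyck_zero_iff A_def atom_orders_def)
  have below: "intervals_below n ?Q = ?F"
    unfolding free_intervals_def A_def by (rule intervals_below_pseudocomplement[OF assms(1)])
  have "finite ?F"
    by (rule finite_subset[of _ "Pow {1..n - 1}"]) (auto simp: free_intervals_def)
  then have "card (\<Union> (max_intervals n ?Q)) = card ({1..n - 1} - A)"
    unfolding max_intervals_def below by (simp add: Union_maximal_elements Union_free_intervals)
  \<comment> \<open>Adjacent pairs are counted by their left member, so 0 is adjoined here but
    \<open>n\<close> is not.\<close>
  moreover have "card ({..<n} - A) = Suc (card ({1..n - 1} - A))"
  proof -
    have "0 < n" using A ne by (cases n) auto
    then have "{..<n} - A = insert 0 ({1..n - 1} - A)" by (auto simp: fin(2))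
    then show ?thesis by simp
  qed
  moreover have "internal_intervals n ?Q =
      {{i<..<j} | i j. i \<in> A \<and> j \<in> A \<and> Suc i < j \<and> A \<inter> {i<..<j} = {}}"
    unfolding internal_intervals_def max_intervals_def below
      internal_maximal_free_intervals[OF A, symmetric] by simp
  then have "Suc (card (internal_intervals n ?Q)) = card {j \<in> A. j - 1 \<notin> A}"
    using card_gaps[OF fin ne] by simp
  \<comment> \<open>Adjacent pairs plus runs of \<open>A\<close> exceed the size of the union by
    one, and the runs exceed the internal intervals by one; the two ones cancel.\<close>
  ultimately show ?thesis
    using num_peaks_eq[OF assms(1)] card_max_intervals[OF assms(1)] card_adjacent_free_pairs[OF A]
    unfolding A_def by linarith
qed

end
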